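(* Let $s_1,\dots,s_n\in\{0,1\}^m$ with $n\ge 3$, let $k$ be an integer, let $\mathrm{OPT}=\min\{\max_i\mathrm{H}(s,s_i): s\in\{0,1\}^m,\ \mathrm{ones}(s)=k\}$, and let $\epsilon\in(0,1)$ satisfy $\mathrm{OPT}\ge\frac{122\ln n}{\epsilon^2}$. Let $(x_1^*,\dots,x_m^*,d^* )$ be an optimal solution of the linear program: minimize $d$ subject to $\sum_{j=1}^m x_j=k$; $\sum_{j: s_i[j]=1}(1-x_j)+\sum_{j: s_i[j]=0}x_j\le d$ for all $i=1,\dots,n$; $x_j\in[0,1]$ for all $j$. Let $x\in\{0,1\}^m$ be random, with the letters $x[j]$ independent and $\Pr[x[j]=1]=x_j^*$. Then \[\Pr\left[|\mathrm{ones}(x)-k|>\tfrac{\epsilon}{2}\mathrm{OPT}\right]<\tfrac14.\]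
   Context: $\mathrm{H}$ denotes Hamming distance, $\mathrm{ones}(s)$ the number of $1$'s in $s$, and $s[j]$ the $j$-th letter of $s$. *)

theory Defs
  imports "HOL-Probability.Probability"
begin

text \<open>Binary strings are Boolean lists, with \<^const>\<open>True\<close> as the letter 1; letter positions
  are numbered from 0.\<close>

definition ones :: "bool list \<Rightarrow> nat" where
  "ones s = card {j. j < length s \<and> s ! j}"

text \<open>Only meant for strings of equal length.\<close>

definition hamming :: "bool list \<Rightarrow> bool list \<Rightarrow> nat" where
  "hamming s t = card {j. j < length s \<and> s ! j \<noteq> t ! j}"

text \<open>The value is unspecified if no string of length \<open>m\<close> has exactly \<open>k\<close> ones, or if \<open>n = 0\<close>.\<close>

definition OPT :: "nat \<Rightarrow> nat \<Rightarrow> (nat \<Rightarrow> bool list) \<Rightarrow> int \<Rightarrow> nat" where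
  "OPT n m s k =
     Min {Max {hamming t (s i) | i. i \<in> {1..n}} | t. length t = m \<and> int (ones t) = k}"

definition lp_feasible ::
  "nat \<Rightarrow> nat \<Rightarrow> (nat \<Rightarrow> bool list) \<Rightarrow> int \<Rightarrow> (nat \<Rightarrow> real) \<Rightarrow> real \<Rightarrow> bool" where
  "lp_feasible n m s k x d \<longleftrightarrow>
     (\<Sum>j<m. x j) = of_int k \<and>
     (\<forall>i\<in>{1..n}. (\<Sum>j | j < m \<and> s i ! j. 1 - x j) + (\<Sum>j | j < m \<and> \<not> s i ! j. x j) \<le> d) \<and>
     (\<forall>j<m. x j \<in> {0..1})"

definition lp_optimal ::
  "nat \<Rightarrow> nat \<Rightarrow> (nat \<Rightarrow> bool list) \<Rightarrow> int \<Rightarrow> (nat \<Rightarrow> real) \<Rightarrow> real \<Rightarrow> bool" where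
  "lp_optimal n m s k x d \<longleftrightarrow>
     lp_feasible n m s k x d \<and> (\<forall>x' d'. lp_feasible n m s k x' d' \<longrightarrow> d \<le> d')"

end

theory Submission
  imports Defs
begin

text \<open>Since \<open>x (1 - x) \<le> min x (1 - x)\<close> on the unit interval, the variance of \<open>ones x\<close> is at most
  the left-hand side of any single distance constraint of the linear program, hence at most its
  optimal value, which is at most \<open>OPT\<close> because strings are integral solutions. The mean of
  \<open>ones x\<close> is \<open>k\<close>, so Chebyshev's inequality bounds the probability by
  \<open>4 / (\<epsilon>\<^sup>2 OPT) \<le> 4 / (122 ln n)\<close>.\<close>

text \<open>Bienayme's identity. Square integrability of the sum is part of the conclusion because
  the induction needs it: \<open>variance_eq\<close> applies to the partial sum only if its square
  is integrable.\<close>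

lemma (in prob_space) indep_vars_sum_square_integrable_variance:
  fixes Y :: "'i \<Rightarrow> 'a \<Rightarrow> real"
  assumes "finite I" and "indep_vars (\<lambda>_. borel) Y I"
    and "\<And>i. i \<in> I \<Longrightarrow> integrable M (\<lambda>\<omega>. (Y i \<omega>)\<^sup>2)"
  shows "integrable M (\<lambda>\<omega>. (\<Sum>i\<in>I. Y i \<omega>)\<^sup>2) \<and>
    variance (\<lambda>\<omega>. \<Sum>i\<in>I. Y i \<omega>) = (\<Sum>i\<in>I. variance (Y i))"
  using assms
proof (induction I rule: finite_induct)
  case empty
  then show ?case by simp
next
  case (insert i I)
  define S where "S = (\<lambda>\<omega>. \<Sum>j\<in>I. Y j \<omega>)"
  have rv: "random_variable borel (Y j)" if "j \<in> insert i I" for j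
    using insert.prems(1) that by (auto simp: indep_vars_def)
  have int: "integrable M (Y j)" if "j \<in> insert i I" for j
    using square_integrable_imp_integrable[OF rv insert.prems(2)] that by blast
  have Y2: "integrable M (\<lambda>\<omega>. (Y i \<omega>)\<^sup>2)"
    using insert.prems(2) by simp
  have IH: "integrable M (\<lambda>\<omega>. (S \<omega>)\<^sup>2)" "variance S = (\<Sum>j\<in>I. variance (Y j))"
    using insert.IH insert.prems indep_vars_subset[OF insert.prems(1), of I]
    unfolding S_def by auto
  have intY: "integrable M (Y i)" and intS: "integrable M S"
    unfolding S_def using int by auto
  \<comment> \<open>As \<open>i\<close> is not in \<open>I\<close>, the new summand is independent
    of the whole partial sum. So the cross term is integrable and its expectation factorizes, and it
    cancels against the cross term of the squared mean.\<close>
  have indep: "indep_var borel (Y i) borel S"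
    unfolding S_def using insert.hyps insert.prems(1) by (rule indep_vars_sum)
  note prod = indep_var_integrable[OF indep intY intS] indep_var_lebesgue_integral[OF indep intY intS]
  have sum: "(\<Sum>j\<in>insert i I. Y j \<omega>) = Y i \<omega> + S \<omega>" for \<omega>
    unfolding S_def using insert.hyps by simp
  have int2: "integrable M (\<lambda>\<omega>. (Y i \<omega> + S \<omega>)\<^sup>2)"
    using Y2 IH(1) prod(1) by (simp add: power2_sum mult.assoc)
  have E2: "expectation (\<lambda>\<omega>. (Y i \<omega> + S \<omega>)\<^sup>2) = expectation (\<lambda>\<omega>. (Y i \<omega>)\<^sup>2)
      + expectation (\<lambda>\<omega>. (S \<omega>)\<^sup>2) + 2 * (expectation (Y i) * expectation S)"
    using Y2 IH(1) prod by (simp add: power2_sum mult.assoc)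
  have "variance (\<lambda>\<omega>. Y i \<omega> + S \<omega>) = variance (Y i) + variance S"
    using variance_eq[OF Bochner_Integration.integrable_add[OF intY intS] int2]
      variance_eq[OF intY Y2] variance_eq[OF intS IH(1)] intY intS E2
    by (simp add: power2_sum)
  then show ?case
    unfolding sum using IH(2) int2 insert.hyps by simp
qed

lemma (in prob_space) expectation_of_bool:
  assumes "random_variable (count_space UNIV) P"
  shows "expectation (\<lambda>\<omega>. of_bool (P \<omega>) :: real) = prob {\<omega> \<in> space M. P \<omega>}"
proof -
  have "{\<omega> \<in> space M. P \<omega>} \<in> events"
    using assms by measurable
  moreover have "expectation (\<lambda>\<omega>. of_bool (P \<omega>) :: real) = expectation (indicator {\<omega> \<in> space M. P \<omega>})"
    by (rule Bochner_Integration.integral_cong) (auto simp: indicator_def)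
  ultimately show ?thesis
    by simp
qed

text \<open>Supplies the facts about a Poisson binomial sum that Chebyshev's inequality consumes:
  measurability, square integrability, mean and variance.\<close>

lemma (in prob_space) bernoulli_sum_expectation_variance:
  fixes P :: "'i \<Rightarrow> 'a \<Rightarrow> bool" and p :: "'i \<Rightarrow> real"
  assumes "finite I" and "indep_vars (\<lambda>_. count_space UNIV) P I"
    and "\<And>i. i \<in> I \<Longrightarrow> prob {\<omega> \<in> space M. P i \<omega>} = p i"
  defines "S \<equiv> (\<lambda>\<omega>. \<Sum>i\<in>I. of_bool (P i \<omega>) :: real)"
  shows "integrable M (\<lambda>\<omega>. (S \<omega>)\<^sup>2)" and "random_variable borel S"
    and "expectation S = (\<Sum>i\<in>I. p i)" and "variance S = (\<Sum>i\<in>I. p i * (1 - p i))"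
proof -
  let ?Y = "\<lambda>i \<omega>. of_bool (P i \<omega>) :: real"
  have rvP: "random_variable (count_space UNIV) (P i)" if "i \<in> I" for i
    using assms(2) that by (simp add: indep_vars_def)
  have rv: "random_variable borel (?Y i)" if "i \<in> I" for i
    by (rule measurable_compose[OF rvP[OF that]]) simp
  have int: "integrable M (?Y i)" if "i \<in> I" for i
    by (rule integrable_const_bound[where B = 1]) (use rv[OF that] in auto)
  \<comment> \<open>A 0/1 variable equals its own square, so its second moment is \<open>p i\<close>
    and its variance is \<open>p i - (p i)\<^sup>2\<close>.\<close>
  have sq: "(\<lambda>\<omega>. (?Y i \<omega>)\<^sup>2) = ?Y i" for i
    by auto
  have E: "expectation (?Y i) = p i" if "i \<in> I" for i
    using expectation_of_bool[OF rvP[OF that]] assms(3)[OF that] by simp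
  have V: "variance (?Y i) = p i * (1 - p i)" if "i \<in> I" for i
    using variance_eq[OF int[OF that]] int[OF that]
    by (simp add: sq E[OF that]) (simp add: power2_eq_square algebra_simps)
  have indep: "indep_vars (\<lambda>_. borel) ?Y I"
    using assms(2) by (rule indep_vars_compose2) simp
  show "random_variable borel S"
    unfolding S_def using rv by measurable
  show "expectation S = (\<Sum>i\<in>I. p i)"
    unfolding S_def using int E by simp
  show "integrable M (\<lambda>\<omega>. (S \<omega>)\<^sup>2)" "variance S = (\<Sum>i\<in>I. p i * (1 - p i))"
    using indep_vars_sum_square_integrable_variance[OF assms(1) indep] int V
    unfolding S_def sq by auto
qed

lemma ones_eq_sum: "real (ones t) = (\<Sum>j<length t. of_bool (t ! j))"
proof -
  have "{j. j < length t \<and> t ! j} = {..<length t} \<inter> {j. t ! j}"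
    by auto
  then show ?thesis
    by (simp add: ones_def)
qed

text \<open>A mismatch with \<open>s i\<close> adds 1 to exactly one of the two sums of the
  constraint, and a match adds 0 to both, so on 0/1 vectors the left-hand side is the Hamming
  distance.\<close>

lemma lp_feasible_string:
  assumes "length t = m" and "int (ones t) = k"
    and "\<And>i. i \<in> {1..n} \<Longrightarrow> hamming t (s i) \<le> d"
  shows "lp_feasible n m s k (\<lambda>j. of_bool (t ! j)) (real d)"
proof -
  have "(\<Sum>j | j < m \<and> s i ! j. 1 - of_bool (t ! j)) + (\<Sum>j | j < m \<and> \<not> s i ! j. of_bool (t ! j))
      = real (hamming t (s i))" for i
  proof -
    \<comment> \<open>Rewriting both summands as the same mismatch indicator lets the two sums merge
      over a partition of \<open>{..<m}\<close>.\<close>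
    have "(\<Sum>j | j < m \<and> s i ! j. 1 - of_bool (t ! j) :: real)
        = (\<Sum>j | j < m \<and> s i ! j. of_bool (t ! j \<noteq> s i ! j))"
      by (rule sum.cong) auto
    moreover have "(\<Sum>j | j < m \<and> \<not> s i ! j. of_bool (t ! j) :: real)
        = (\<Sum>j | j < m \<and> \<not> s i ! j. of_bool (t ! j \<noteq> s i ! j))"
      by (rule sum.cong) auto
    moreover have "{j. j < m \<and> s i ! j} \<union> {j. j < m \<and> \<not> s i ! j} = {..<m}"
      by auto
    moreover have "{j. j < m \<and> t ! j \<noteq> s i ! j} = {..<m} \<inter> {j. t ! j \<noteq> s i ! j}"
      by auto
    ultimately show ?thesis
      using sum.union_disjoint[of "{j. j < m \<and> s i ! j}" "{j. j < m \<and> \<not> s i ! j}"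
          "\<lambda>j. of_bool (t ! j \<noteq> s i ! j) :: real"]
      by (fastforce simp: hamming_def assms(1))
  qed
  then show ?thesis
    using assms ones_eq_sum[of t] unfolding lp_feasible_def by auto
qed

text \<open>The bounds on \<open>k\<close> provide a string with \<open>k\<close> ones, so
  \<open>Min\<close> ranges over a nonempty finite set and is one of its elements; otherwise
  \<open>OPT\<close> would be unspecified.\<close>

lemma OPT_attained:
  assumes "n \<ge> 1" and "0 \<le> k" and "k \<le> int m"
  obtains t where "length t = m" and "int (ones t) = k"
    and "\<And>i. i \<in> {1..n} \<Longrightarrow> hamming t (s i) \<le> OPT n m s k"
proof -
  let ?F = "\<lambda>t. Max {hamming t (s i) | i. i \<in> {1..n}}"
  let ?T = "{t. length t = m \<and> int (ones t) = k}"
  have "finite ?T"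
    by (rule finite_subset[OF _ finite_lists_length_eq[of UNIV m]]) auto
  moreover have "?T \<noteq> {}"
  proof -
    \<comment> \<open>The witness has its ones in the first \<open>k\<close> positions;
      \<open>k \<le> int m\<close> ensures that they fit.\<close>
    let ?t = "map (\<lambda>j. j < nat k) [0..<m]"
    have "{j. j < length ?t \<and> ?t ! j} = {..<nat k}"
      using assms by auto
    then show ?thesis
      using assms(2) unfolding ones_def
      by (intro ex_in_conv[THEN iffD1] exI[of _ ?t]) simp
  qed
  moreover have "{?F t | t. length t = m \<and> int (ones t) = k} = ?F ` ?T"
    by auto
  ultimately have "OPT n m s k \<in> ?F ` ?T"
    unfolding OPT_def by (simp only: Min_in finite_imageI image_is_empty not_False_eq_True)
  then obtain t where t: "length t = m" "int (ones t) = k" "OPT n m s k = ?F t"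
    by auto
  moreover have "hamming t (s i) \<le> ?F t" if "i \<in> {1..n}" for i
    by (rule Max_ge) (use that in auto)
  ultimately show thesis
    using that by metis
qed

lemma lp_optimal_le_OPT:
  assumes "n \<ge> 1" and "lp_optimal n m s k x d"
  shows "d \<le> real (OPT n m s k)"
proof -
  have x: "(\<Sum>j<m. x j) = of_int k" "\<And>j. j < m \<Longrightarrow> 0 \<le> x j \<and> x j \<le> 1"
    using assms(2) by (auto simp: lp_optimal_def lp_feasible_def)
  \<comment> \<open>The range of \<open>k\<close> is not assumed; it follows from feasibility,
    \<open>k\<close> being a sum of \<open>m\<close> numbers in the unit interval.\<close>
  have "0 \<le> (\<Sum>j<m. x j)" "(\<Sum>j<m. x j) \<le> (\<Sum>j<m. 1)"
    using x(2) by (auto intro!: sum_nonneg simp del: sum_constant intro: sum_mono)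
  then have "0 \<le> k" "k \<le> int m"
    using x(1) by auto
  with assms(1) obtain t where "length t = m" "int (ones t) = k"
    "\<And>i. i \<in> {1..n} \<Longrightarrow> hamming t (s i) \<le> OPT n m s k"
    by (rule OPT_attained[where s = s]) blast
  then show ?thesis
    using assms(2) lp_feasible_string unfolding lp_optimal_def by blast
qed

lemma lp_feasible_variance_le:
  assumes "n \<ge> 1" and "lp_feasible n m s k x d"
  shows "(\<Sum>j<m. x j * (1 - x j)) \<le> d"
proof -
  have x: "0 \<le> x j" "x j \<le> 1" if "j < m" for j
    using assms(2) that by (auto simp: lp_feasible_def)
  \<comment> \<open>One constraint suffices, and \<open>n \<ge> 1\<close> guarantees that index 1
    has one. Its string decides, position by position, which bound on \<open>x j * (1 - x j)\<close>
    is used: \<open>1 - x j\<close> at a one, \<open>x j\<close> at a zero.\<close>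
  have "{..<m} = {j. j < m \<and> s 1 ! j} \<union> {j. j < m \<and> \<not> s 1 ! j}"
    by auto
  then have "(\<Sum>j<m. x j * (1 - x j)) = (\<Sum>j | j < m \<and> s 1 ! j. x j * (1 - x j))
      + (\<Sum>j | j < m \<and> \<not> s 1 ! j. x j * (1 - x j))"
    by (simp only:) (rule sum.union_disjoint, auto)
  also have "\<dots> \<le> (\<Sum>j | j < m \<and> s 1 ! j. 1 - x j) + (\<Sum>j | j < m \<and> \<not> s 1 ! j. x j)"
    using x by (intro add_mono sum_mono) (auto intro: mult_left_le_one_le mult_right_le_one_le)
  also have "\<dots> \<le> d"
    using assms by (auto simp: lp_feasible_def)
  finally show ?thesis .
qed

theorem lemma4:
  fixes n m :: nat and s :: "nat \<Rightarrow> bool list" and k :: int and \<epsilon> :: real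
    and xs :: "nat \<Rightarrow> real" and ds :: real
    and M :: "'a measure" and x :: "'a \<Rightarrow> bool list"
  assumes "n \<ge> 3"
    and "\<And>i. i \<in> {1..n} \<Longrightarrow> length (s i) = m"
    and "0 < \<epsilon>" and "\<epsilon> < 1"
    and "real (OPT n m s k) \<ge> 122 * ln (real n) / \<epsilon>\<^sup>2"
    and "lp_optimal n m s k xs ds"
    and "prob_space M"
    and "\<And>\<omega>. \<omega> \<in> space M \<Longrightarrow> length (x \<omega>) = m"
    and "prob_space.indep_vars M (\<lambda>_. count_space UNIV) (\<lambda>j \<omega>. x \<omega> ! j) {..<m}"
    and "\<And>j. j < m \<Longrightarrow> measure M {\<omega> \<in> space M. x \<omega> ! j} = xs j"
  shows "measure M {\<omega> \<in> space M.
           \<bar>real (ones (x \<omega>)) - real_of_int k\<bar> > \<epsilon> / 2 * real (OPT n m s k)} < 1 / 4"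
proof -
  interpret prob_space M by fact
  define opt where "opt = real (OPT n m s k)"
  define S where "S = (\<lambda>\<omega>. \<Sum>j<m. of_bool (x \<omega> ! j) :: real)"
  have feas: "lp_feasible n m s k xs ds"
    using assms(6) by (simp add: lp_optimal_def)
  have S: "integrable M (\<lambda>\<omega>. (S \<omega>)\<^sup>2)" "random_variable borel S"
    "expectation S = (\<Sum>j<m. xs j)" "variance S = (\<Sum>j<m. xs j * (1 - xs j))"
    unfolding S_def using bernoulli_sum_expectation_variance[OF _ assms(9), of xs] assms(10) by auto
  have mean: "expectation S = of_int k"
    using S(3) feas by (simp add: lp_feasible_def)
  have "variance S \<le> ds"
    using S(4) lp_feasible_variance_le[OF _ feas] assms(1) by simp
  also have "ds \<le> opt"
    unfolding opt_def using lp_optimal_le_OPT[OF _ assms(6)] assms(1) by simp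
  finally have var: "variance S \<le> opt" .
  \<comment> \<open>A crude bound: ln(1/n) \<le> 1/n - 1 \<le> -2/3 already gives ln n \<ge> 2/3.
    The value 1/2 turns the constant 122 into 61.\<close>
  have "1 / 2 \<le> ln (real n)"
  proof -
    have "ln (1 / real n) \<le> 1 / real n - 1"
      using assms(1) by (intro ln_le_minus_one) simp
    moreover have "1 / real n \<le> 1 / 3"
      using assms(1) by (intro divide_left_mono) auto
    moreover have "ln (1 / real n) = - ln (real n)"
      using assms(1) by (simp add: ln_div)
    ultimately show ?thesis
      by linarith
  qed
  then have large: "61 \<le> \<epsilon>\<^sup>2 * opt"
    using assms(3,5) by (simp add: opt_def field_simps)
  then have pos: "0 < opt"
    using assms(3) by (smt (verit) zero_less_mult_iff zero_less_power)
  let ?a = "\<epsilon> / 2 * opt"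
  \<comment> \<open>Chebyshev's inequality concerns the event with a non-strict inequality, which
    contains the given one. The length of \<open>x \<omega>\<close> identifies
    \<open>ones (x \<omega>)\<close> with \<open>S \<omega>\<close>.\<close>
  have "prob {\<omega> \<in> space M. \<bar>real (ones (x \<omega>)) - of_int k\<bar> > ?a}
      \<le> prob {\<omega> \<in> space M. \<bar>S \<omega> - expectation S\<bar> \<ge> ?a}"
  proof (rule finite_measure_mono)
    show "{\<omega> \<in> space M. \<bar>S \<omega> - expectation S\<bar> \<ge> ?a} \<in> events"
      using S(2) by measurable
    show "{\<omega> \<in> space M. \<bar>real (ones (x \<omega>)) - of_int k\<bar> > ?a}
        \<subseteq> {\<omega> \<in> space M. \<bar>S \<omega> - expectation S\<bar> \<ge> ?a}"
      unfolding mean using assms(8) by (auto simp: ones_eq_sum S_def)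
  qed
  also have "\<dots> \<le> variance S / ?a\<^sup>2"
    using assms(3) pos by (intro Chebyshev_inequality S) simp
  also have "\<dots> \<le> opt / ?a\<^sup>2"
    using var by (rule divide_right_mono) simp
  also have "\<dots> = 4 / (\<epsilon>\<^sup>2 * opt)"
    using pos by (simp add: power2_eq_square)
  \<comment> \<open>The quotient is at most 4/61; anything above 16 in place of 61 would do.\<close>
  also have "\<dots> < 1 / 4"
    using large by (simp add: field_simps)
  finally show ?thesis
    by (simp add: opt_def)
qed

end
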